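(* For every real $t>0$ the ternary sextic form $$R_t(x,y,z)=\left(\frac{t^4+2t^2-3}{3}\right)(x^3-xz^2)^2+\left(\frac{1+2t^2-3t^4}{3t^4}\right)(y^3-yz^2)^2+R(x,y,z)$$ belongs to $\Delta_{3,6}$ and has exactly ten zeros, and $R_1=R$.
   Context: Here $$R(x,y,z)=x^6+y^6+z^6-x^4y^2-x^2y^4-x^4z^2-y^4z^2-x^2z^4-y^2z^4+3x^2y^2z^2.$$ $\Delta_{3,6}$ is the set of real ternary sextic forms that are psd (nonnegative on $\mathbb R^3$) but not sos (not a finite sum of squares of real forms). The zeros of a form are its nonzero real zeros, counted as lines through the origin (real projective points). *)

theory Defs
  imports "HOL-Analysis.Analysis" "HOL-Library.Poly_Mapping"
begin

(* The polynomial ring over the reals in three variables, indexed by the three-element type 3: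
   a polynomial maps each exponent vector to its coefficient, and the ring operations
   (convolution) are those of Poly_Mapping. *)
type_synonym ternary_poly = "(3 \<Rightarrow>\<^sub>0 nat) \<Rightarrow>\<^sub>0 real"

definition Const :: "real \<Rightarrow> ternary_poly" where
  "Const c = Poly_Mapping.single 0 c"

definition Var :: "3 \<Rightarrow> ternary_poly" where
  "Var i = Poly_Mapping.single (Poly_Mapping.single i 1) 1"

definition peval :: "ternary_poly \<Rightarrow> real ^ 3 \<Rightarrow> real" where
  "peval p v = (\<Sum>m\<in>Poly_Mapping.keys p.
      Poly_Mapping.lookup p m * (\<Prod>i\<in>UNIV. (v $ i) ^ Poly_Mapping.lookup m i))"

(* As usual, the zero polynomial counts as a form of every degree. *)
definition is_form :: "nat \<Rightarrow> ternary_poly \<Rightarrow> bool" where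
  "is_form d p \<longleftrightarrow> (\<forall>m\<in>Poly_Mapping.keys p. (\<Sum>i\<in>UNIV. Poly_Mapping.lookup m i) = d)"

definition psd :: "ternary_poly \<Rightarrow> bool" where
  "psd p \<longleftrightarrow> (\<forall>v. peval p v \<ge> 0)"

definition sos :: "ternary_poly \<Rightarrow> bool" where
  "sos p \<longleftrightarrow> (\<exists>(n::nat) q. (\<forall>k<n. \<exists>d. is_form d (q k)) \<and> p = (\<Sum>k<n. (q k)\<^sup>2))"

definition Delta_3_6 :: "ternary_poly set" where
  "Delta_3_6 = {p. is_form 6 p \<and> psd p \<and> \<not> sos p}"

(* Real projective points are represented as lines through the origin. *)
definition zero_lines :: "ternary_poly \<Rightarrow> (real ^ 3) set set" where
  "zero_lines p = {span {v} | v. v \<noteq> 0 \<and> peval p v = 0}"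

definition R_form :: ternary_poly where
  "R_form = (let x = Var 1; y = Var 2; z = Var 3 in
     x^6 + y^6 + z^6 - x^4 * y^2 - x^2 * y^4 - x^4 * z^2 - y^4 * z^2 - x^2 * z^4 - y^2 * z^4
       + 3 * x^2 * y^2 * z^2)"

definition Rt_form :: "real \<Rightarrow> ternary_poly" where
  "Rt_form t = (let x = Var 1; y = Var 2; z = Var 3 in
     Const ((t^4 + 2 * t^2 - 3) / 3) * (x^3 - x * z^2)^2
       + Const ((1 + 2 * t^2 - 3 * t^4) / (3 * t^4)) * (y^3 - y * z^2)^2
       + R_form)"

end

(* In the squares X, Y, Z of the variables, R_t is a cubic F that is singular at (1,1,1). Hence
   F(X,Y,Z) = m Q(X-Z, Y-Z) + F(X-m, Y-m, Z-m) with a quadratic form Q that is positive definite.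
   Taking m = min(X,Y,Z) leaves a point on a face of the orthant, where F is a square times a
   nonnegative linear form; this gives positivity and all the zeros.
   If R_t were a sum of squares, each summand would vanish at the eight zeros
   (1,1), ..., (0,-1) of the affine grid {-1,0,1}^2 and therefore, being cubic, also at its centre
   (0,0,1), where R_t = 1. *)
theory Submission
  imports Defs
begin

section \<open>Evaluation as a ring homomorphism\<close>

definition monom_eval :: "(3 \<Rightarrow>\<^sub>0 nat) \<Rightarrow> real ^ 3 \<Rightarrow> real" where
  "monom_eval m v = (\<Prod>i\<in>UNIV. (v $ i) ^ Poly_Mapping.lookup m i)"

lemma monom_eval_3:
  "monom_eval m v = v $ 1 ^ Poly_Mapping.lookup m 1 * v $ 2 ^ Poly_Mapping.lookup m 2
     * v $ 3 ^ Poly_Mapping.lookup m 3"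
  unfolding monom_eval_def UNIV_3 by (simp add: mult.assoc)

lemma monom_eval_add: "monom_eval (m + n) v = monom_eval m v * monom_eval n v"
  by (simp add: monom_eval_def lookup_add power_add prod.distrib)

lemma peval_alt: "peval p v = (\<Sum>m\<in>Poly_Mapping.keys p. Poly_Mapping.lookup p m * monom_eval m v)"
  by (simp add: peval_def monom_eval_def)

text \<open>Cancellation can shrink the support of a sum; a common index set lets \<open>p\<close>,
  \<open>q\<close> and \<open>p + q\<close> be compared termwise.\<close>

lemma peval_superset:
  assumes "finite A" "Poly_Mapping.keys p \<subseteq> A"
  shows "peval p v = (\<Sum>m\<in>A. Poly_Mapping.lookup p m * monom_eval m v)"
  unfolding peval_alt using assms
  by (intro sum.mono_neutral_left) (auto simp: in_keys_iff)

lemma peval_add [simp]: "peval (p + q) v = peval p v + peval q v"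
proof -
  let ?A = "Poly_Mapping.keys p \<union> Poly_Mapping.keys q"
  have "peval (p + q) v = (\<Sum>m\<in>?A. Poly_Mapping.lookup (p + q) m * monom_eval m v)"
    by (intro peval_superset keys_add) simp
  also have "\<dots> = peval p v + peval q v"
    by (simp add: peval_superset[of ?A p] peval_superset[of ?A q] lookup_add
        distrib_right sum.distrib)
  finally show ?thesis .
qed

lemma peval_zero [simp]: "peval 0 v = 0"
  by (simp add: peval_def)

lemma peval_diff [simp]: "peval (p - q) v = peval p v - peval q v"
  using peval_add[of "p - q" q v] by simp

lemma peval_single: "peval (Poly_Mapping.single m c) v = c * monom_eval m v"
  by (cases "c = 0") (simp_all add: peval_alt)

text \<open>Overwriting the zero coefficient at a fresh key amounts to adding a single term. This
  reduces multiplicativity of evaluation to monomials.\<close>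

lemma poly_mapping_add_single_induct [case_names zero add_single]:
  assumes "P 0" and "\<And>m c p. P p \<Longrightarrow> P (Poly_Mapping.single m c + p)"
  shows "P p"
proof (induction p rule: update_induct)
  case const
  show ?case by (rule assms(1))
next
  case (update f k v)
  have "Poly_Mapping.update k v f = Poly_Mapping.single k v + f"
    using update(1) by (intro poly_mapping_eqI)
      (auto simp: lookup_add lookup_update lookup_single when_def in_keys_iff)
  with update assms(2) show ?case by simp
qed

lemma peval_single_mult:
  "peval (Poly_Mapping.single m c * q) v = c * monom_eval m v * peval q v"
  by (induction q rule: poly_mapping_add_single_induct)
    (simp_all add: distrib_left mult_single peval_single monom_eval_add)

lemma peval_mult [simp]: "peval (p * q) v = peval p v * peval q v"
  by (induction p rule: poly_mapping_add_single_induct)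
    (simp_all add: distrib_right peval_single peval_single_mult)

lemma peval_Const [simp]: "peval (Const c) v = c"
  by (simp add: Const_def peval_single monom_eval_def)

lemma peval_one [simp]: "peval 1 v = 1"
  using peval_Const[of 1 v] by (simp add: Const_def)

lemma peval_numeral [simp]: "peval (numeral n) v = numeral n"
  by (induction n) (simp_all only: numeral.simps peval_add peval_one)

lemma peval_power [simp]: "peval (p ^ n) v = peval p v ^ n"
  by (induction n) simp_all

lemma peval_Var [simp]: "peval (Var i) v = v $ i"
proof -
  have "monom_eval (Poly_Mapping.single i 1) v = (\<Prod>j\<in>UNIV. if i = j then v $ j else 1)"
    unfolding monom_eval_def by (rule prod.cong) (auto simp: lookup_single)
  then show ?thesis by (simp add: Var_def peval_single)
qed

lemma peval_sum [simp]: "peval (\<Sum>k\<in>A. f k) v = (\<Sum>k\<in>A. peval (f k) v)"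
  by (induction A rule: infinite_finite_induct) simp_all

section \<open>Degrees of forms and scaling\<close>

lemma is_form_add: "is_form d p \<Longrightarrow> is_form d q \<Longrightarrow> is_form d (p + q)"
  unfolding is_form_def using keys_add[of p q] by blast

lemma is_form_diff: "is_form d p \<Longrightarrow> is_form d q \<Longrightarrow> is_form d (p - q)"
  unfolding is_form_def using keys_diff[of p q] by blast

text \<open>The degree \<open>n\<close> with a separate equation lets the rule match literal degrees
  such as 6.\<close>

lemma is_form_mult:
  assumes "is_form d p" "is_form e q" "n = d + e"
  shows "is_form n (p * q)"
  unfolding is_form_def
proof
  fix m assume "m \<in> Poly_Mapping.keys (p * q)"
  then obtain a b where "m = a + b" "a \<in> Poly_Mapping.keys p" "b \<in> Poly_Mapping.keys q"
    using keys_mult[of p q] by blast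
  then show "(\<Sum>i\<in>UNIV. Poly_Mapping.lookup m i) = n"
    using assms by (simp add: is_form_def lookup_add sum.distrib)
qed

lemma is_form_Const: "is_form 0 (Const c)"
  by (simp add: is_form_def Const_def)

lemma is_form_one: "is_form 0 1"
  using is_form_Const[of 1] by (simp add: Const_def)

lemma is_form_numeral: "is_form 0 (numeral n)"
  by (induction n) (simp_all only: numeral.simps is_form_add is_form_one)

lemma is_form_Var: "is_form 1 (Var i)"
  by (simp add: is_form_def Var_def lookup_single when_def)

lemma is_form_power: "is_form d p \<Longrightarrow> n = k * d \<Longrightarrow> is_form n (p ^ k)"
  by (induction k arbitrary: n) (simp_all add: is_form_one is_form_mult)

lemma is_form_Var_power: "is_form n (Var i ^ n)"
  by (rule is_form_power[OF is_form_Var]) simp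

lemma is_form_R_form: "is_form 6 R_form"
proof -
  have 1: "is_form 6 (Var i ^ 4 * Var j ^ 2)" for i j
    by (rule is_form_mult[OF is_form_Var_power is_form_Var_power]) simp
  have 2: "is_form 6 (Var i ^ 2 * Var j ^ 4)" for i j
    by (rule is_form_mult[OF is_form_Var_power is_form_Var_power]) simp
  have "is_form 2 (3 * Var i ^ 2)" for i
    by (rule is_form_mult[OF is_form_numeral is_form_Var_power]) simp
  then have "is_form 4 (3 * Var i ^ 2 * Var j ^ 2)" for i j
    by (rule is_form_mult[OF _ is_form_Var_power]) simp
  then have 3: "is_form 6 (3 * Var i ^ 2 * Var j ^ 2 * Var k ^ 2)" for i j k
    by (rule is_form_mult[OF _ is_form_Var_power]) simp
  show ?thesis
    unfolding R_form_def Let_def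
    by (intro is_form_add is_form_diff is_form_Var_power 1 2 3)
qed

lemma is_form_Rt_form: "is_form 6 (Rt_form t)"
proof -
  have "is_form 3 (Var i * Var j ^ 2)" for i j
    by (rule is_form_mult[OF is_form_Var is_form_Var_power]) simp
  then have "is_form 3 (Var i ^ 3 - Var i * Var j ^ 2)" for i j
    by (intro is_form_diff is_form_Var_power)
  then have "is_form 6 ((Var i ^ 3 - Var i * Var j ^ 2) ^ 2)" for i j
    by (rule is_form_power) simp
  then have "is_form 6 (Const c * (Var i ^ 3 - Var i * Var j ^ 2) ^ 2)" for c i j
    by (rule is_form_mult[OF is_form_Const]) simp
  then show ?thesis
    unfolding Rt_form_def Let_def by (intro is_form_add is_form_R_form)
qed

text \<open>This serves to compare the growth of a summand and of R_t along a ray.\<close>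

lemma peval_form_scale:
  assumes "is_form d p"
  shows "peval p (c *\<^sub>R v) = c ^ d * peval p v"
proof -
  have "monom_eval m (c *\<^sub>R v) = c ^ d * monom_eval m v" if "m \<in> Poly_Mapping.keys p" for m
    using assms that by (simp add: is_form_def monom_eval_def power_mult_distrib prod.distrib
        flip: power_sum)
  then show ?thesis
    by (simp add: peval_alt sum_distrib_left mult_ac)
qed

section \<open>Cubics vanishing on the outer points of a grid\<close>

text \<open>The weights are the products of (1, -2, 1) in \<open>x\<close> with (1, -2, 1) in
  \<open>y\<close>, that is, the second difference taken in each variable at the origin.\<close>

definition grid_difference :: "(real \<Rightarrow> real \<Rightarrow> real) \<Rightarrow> real" where
  "grid_difference f = f 1 1 + f 1 (- 1) + f (- 1) 1 + f (- 1) (- 1)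
     - 2 * (f 1 0 + f (- 1) 0 + f 0 1 + f 0 (- 1)) + 4 * f 0 0"

lemma grid_difference_sum:
  "grid_difference (\<lambda>x y. \<Sum>m\<in>M. c m * f m x y) = (\<Sum>m\<in>M. c m * grid_difference (f m))"
  by (induction M rule: infinite_finite_induct)
    (simp_all add: grid_difference_def distrib_left right_diff_distrib)

text \<open>The difference factors into one-variable second differences, and one of the two
  exponents is below 2.\<close>

lemma grid_difference_monomial:
  assumes "a + b \<le> 3"
  shows "grid_difference (\<lambda>x y. x ^ a * y ^ b) = 0"
proof -
  \<comment> \<open>For \<open>n = 0\<close> this relies on \<open>0 ^ 0 = 1\<close>.\<close>
  have *: "(- 1) ^ n - 2 * 0 ^ n + 1 = (0 :: real)" if "n < 2" for n :: nat
    using that by (auto simp: less_Suc_eq numeral_2_eq_2)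
  have "grid_difference (\<lambda>x y. x ^ a * y ^ b) =
      ((- 1) ^ a - 2 * 0 ^ a + 1) * ((- 1) ^ b - 2 * 0 ^ b + 1)"
    unfolding grid_difference_def power_one by algebra
  moreover have "a < 2 \<or> b < 2" using assms by linarith
  ultimately show ?thesis
    using *[of a] *[of b] by auto
qed

text \<open>This is the Cayley--Bacharach phenomenon for the grid \<open>{-1, 0, 1}\<^sup>2\<close>: the second
  difference in both variables annihilates every monomial that is not divisible by
  \<open>x\<^sup>2y\<^sup>2\<close>, so the value at the central point is determined by the eight outer ones.\<close>

lemma low_degree_form_vanishes_at_centre:
  assumes form: "is_form d q" and "d \<le> 3"
    and corners: "peval q (vector [1, 1, 1]) = 0" "peval q (vector [1, - 1, 1]) = 0"
      "peval q (vector [- 1, 1, 1]) = 0" "peval q (vector [- 1, - 1, 1]) = 0"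
    and edges: "peval q (vector [1, 0, 1]) = 0" "peval q (vector [- 1, 0, 1]) = 0"
      "peval q (vector [0, 1, 1]) = 0" "peval q (vector [0, - 1, 1]) = 0"
  shows "peval q (vector [0, 0, 1]) = 0"
proof -
  let ?K = "Poly_Mapping.keys q" and ?c = "Poly_Mapping.lookup q"
  have mono: "grid_difference (\<lambda>x y. monom_eval m (vector [x, y, 1])) = 0"
    if "m \<in> ?K" for m
  proof -
    have "(\<Sum>i\<in>UNIV. Poly_Mapping.lookup m i) \<le> 3"
      using form that \<open>d \<le> 3\<close> by (simp add: is_form_def)
    then have "Poly_Mapping.lookup m 1 + Poly_Mapping.lookup m 2 \<le> 3"
      unfolding sum_3 by linarith
    then show ?thesis
      by (simp add: monom_eval_3 grid_difference_monomial)
  qed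
  have "grid_difference (\<lambda>x y. peval q (vector [x, y, 1])) =
      (\<Sum>m\<in>?K. ?c m * grid_difference (\<lambda>x y. monom_eval m (vector [x, y, 1])))"
    unfolding peval_alt by (rule grid_difference_sum)
  also have "\<dots> = 0"
    using mono by (intro sum.neutral) simp
  finally show ?thesis
    using corners edges by (simp add: grid_difference_def)
qed

section \<open>The cubic in the squares of the variables\<close>

text \<open>Here \<open>s\<close> stands for \<open>t^2\<close>. The last three terms are Schur's
  expression, which is R written in the squares.\<close>

definition rt_cubic :: "real \<Rightarrow> real \<Rightarrow> real \<Rightarrow> real \<Rightarrow> real" where
  "rt_cubic s X Y Z = (s\<^sup>2 + 2 * s - 3) / 3 * (X * (X - Z)\<^sup>2)
     + (1 + 2 * s - 3 * s\<^sup>2) / (3 * s\<^sup>2) * (Y * (Y - Z)\<^sup>2)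
     + X * (X - Y) * (X - Z) + Y * (Y - X) * (Y - Z) + Z * (Z - X) * (Z - Y)"

text \<open>This is the coefficient of \<open>m\<close> in
  \<open>rt_cubic s (X + m) (Y + m) (Z + m)\<close>, with \<open>u = X - Z\<close> and
  \<open>v = Y - Z\<close>.\<close>

definition rt_quadratic :: "real \<Rightarrow> real \<Rightarrow> real \<Rightarrow> real" where
  "rt_quadratic s u v = (s\<^sup>2 + 2 * s) / 3 * u\<^sup>2 - u * v + (1 + 2 * s) / (3 * s\<^sup>2) * v\<^sup>2"

lemma peval_Rt_form:
  "peval (Rt_form t) v = rt_cubic (t\<^sup>2) ((v $ 1)\<^sup>2) ((v $ 2)\<^sup>2) ((v $ 3)\<^sup>2)"
proof -
  define x y z where "x = v $ 1" and "y = v $ 2" and "z = v $ 3"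
  define a b where "a = (t^4 + 2 * t^2 - 3) / 3" and "b = (1 + 2 * t^2 - 3 * t^4) / (3 * t^4)"
  have "peval (Rt_form t) v = a * (x^3 - x * z^2)^2 + b * (y^3 - y * z^2)^2
      + (x^6 + y^6 + z^6 - x^4 * y^2 - x^2 * y^4 - x^4 * z^2 - y^4 * z^2 - x^2 * z^4 - y^2 * z^4
       + 3 * x^2 * y^2 * z^2)"
    by (simp add: Rt_form_def R_form_def Let_def a_def b_def x_def y_def z_def)
  also have "\<dots> = a * (x\<^sup>2 * (x\<^sup>2 - z\<^sup>2)\<^sup>2) + b * (y\<^sup>2 * (y\<^sup>2 - z\<^sup>2)\<^sup>2)
     + x\<^sup>2 * (x\<^sup>2 - y\<^sup>2) * (x\<^sup>2 - z\<^sup>2) + y\<^sup>2 * (y\<^sup>2 - x\<^sup>2) * (y\<^sup>2 - z\<^sup>2)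
     + z\<^sup>2 * (z\<^sup>2 - x\<^sup>2) * (z\<^sup>2 - y\<^sup>2)"
    by algebra
  finally show ?thesis
    by (simp add: rt_cubic_def a_def b_def x_def y_def z_def flip: power_mult)
qed

text \<open>Completing the square leaves the factor \<open>4 * A * B - 1\<close>, a fraction whose
  numerator in \<open>s\<close> has only positive coefficients.\<close>

lemma rt_quadratic_pos:
  assumes "s > 0" "u \<noteq> 0 \<or> v \<noteq> 0"
  shows "rt_quadratic s u v > 0"
proof -
  define A B where "A = (s\<^sup>2 + 2 * s) / 3" and "B = (1 + 2 * s) / (3 * s\<^sup>2)"
  have A: "A > 0" and B: "B > 0"
    using \<open>s > 0\<close> by (simp_all add: A_def B_def add_pos_pos)
  have "4 * A * B - 1 = (8 * s\<^sup>2 + 11 * s + 8) / (9 * s)"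
    using \<open>s > 0\<close> by (simp add: A_def B_def field_simps power2_eq_square)
  then have AB: "4 * A * B - 1 > 0"
    using \<open>s > 0\<close> by (simp add: add_pos_pos)
  have eq: "4 * A * rt_quadratic s u v = (2 * A * u - v)\<^sup>2 + (4 * A * B - 1) * v\<^sup>2"
    unfolding rt_quadratic_def A_def[symmetric] B_def[symmetric]
    by (simp add: algebra_simps power2_eq_square)
  have "\<dots> > 0"
  proof (cases "v = 0")
    case True
    with assms A show ?thesis by simp
  next
    case False
    with AB show ?thesis by (intro add_nonneg_pos) simp_all
  qed
  then have "4 * A * rt_quadratic s u v > 0"
    by (simp only: eq)
  with A show ?thesis
    by (simp add: zero_less_mult_iff)
qed

text \<open>The cubic is singular at \<open>(1, 1, 1)\<close>, so it is affine along lines in that direction.\<close>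

lemma rt_cubic_shift:
  assumes "s > 0"
  shows "rt_cubic s X Y Z = m * rt_quadratic s (X - Z) (Y - Z) + rt_cubic s (X - m) (Y - m) (Z - m)"
proof -
  define a b where "a = (s\<^sup>2 + 2 * s - 3) / 3" and "b = (1 + 2 * s - 3 * s\<^sup>2) / (3 * s\<^sup>2)"
  \<comment> \<open>Expressed through \<open>a\<close> and \<open>b\<close>, both sides lose their
    denominators and \<open>s\<close> itself, leaving a polynomial identity.\<close>
  have eq: "(s\<^sup>2 + 2 * s) / 3 = a + 1" "(1 + 2 * s) / (3 * s\<^sup>2) = b + 1"
    using assms by (simp_all add: a_def b_def field_simps)
  show ?thesis
    unfolding rt_cubic_def rt_quadratic_def eq a_def[symmetric] b_def[symmetric]
    by algebra
qed

text \<open>The two coefficients depending on \<open>s\<close> are such that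
  \<open>Y = s * X\<close> is a double root on the face \<open>Z = 0\<close>; on the other two faces
  the double root stays on the diagonal.\<close>

lemma rt_cubic_faces:
  assumes "s > 0"
  shows "rt_cubic s X Y 0 = (Y - s * X)\<^sup>2 * ((1 + 2 * s) / (3 * s\<^sup>2) * Y + (s + 2) / (3 * s) * X)"
    and "rt_cubic s 0 Y Z = (Y - Z)\<^sup>2 * ((1 + 2 * s) / (3 * s\<^sup>2) * Y + Z)"
    and "rt_cubic s X 0 Z = (X - Z)\<^sup>2 * ((s\<^sup>2 + 2 * s) / 3 * X + Z)"
  using assms unfolding rt_cubic_def
  by (simp_all add: divide_simps) algebra+

lemma rt_cubic_face_nonneg:
  assumes "s > 0" "X \<ge> 0" "Y \<ge> 0" "Z \<ge> 0" "X = 0 \<or> Y = 0 \<or> Z = 0"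
  shows "rt_cubic s X Y Z \<ge> 0"
  using assms by (auto simp: rt_cubic_faces)

text \<open>On a face of the orthant the linear cofactor vanishes only at the origin, which
  satisfies the listed equations as well.\<close>

lemma rt_cubic_face_eq_0:
  assumes "s > 0" "X \<ge> 0" "Y \<ge> 0" "Z \<ge> 0" "X = 0 \<or> Y = 0 \<or> Z = 0" "rt_cubic s X Y Z = 0"
  shows "X = 0 \<and> Y = Z \<or> Y = 0 \<and> X = Z \<or> Z = 0 \<and> Y = s * X"
proof -
  have pos: "p * a + q * b = 0 \<longleftrightarrow> a = 0 \<and> b = 0"
    if "p > 0" "q > 0" "a \<ge> 0" "b \<ge> 0" for p q a b :: real
    using that by (simp add: add_nonneg_eq_0_iff)
  have c: "(1 + 2 * s) / (3 * s\<^sup>2) > 0" "(s + 2) / (3 * s) > 0" "(s\<^sup>2 + 2 * s) / 3 > 0"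
    using \<open>s > 0\<close> by (simp_all add: add_pos_pos)
  from assms(5) consider "X = 0" | "Y = 0" | "Z = 0" by blast
  then show ?thesis
  proof cases
    case 1
    with assms pos[OF c(1), of 1 Y Z] show ?thesis by (auto simp: rt_cubic_faces)
  next
    case 2
    with assms pos[OF c(3), of 1 X Z] show ?thesis by (auto simp: rt_cubic_faces)
  next
    case 3
    with assms pos[OF c(1,2), of Y X] show ?thesis by (auto simp: rt_cubic_faces)
  qed
qed

lemma rt_cubic_nonneg_and_zeros:
  assumes "s > 0" "X \<ge> 0" "Y \<ge> 0" "Z \<ge> 0"
  shows "rt_cubic s X Y Z \<ge> 0"
    and "rt_cubic s X Y Z = 0 \<longleftrightarrow>
      X = Y \<and> Y = Z \<or> X = 0 \<and> Y = Z \<or> Y = 0 \<and> X = Z \<or> Z = 0 \<and> Y = s * X"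
proof -
  define m where "m = min X (min Y Z)"
  have m: "m \<ge> 0" "X - m \<ge> 0" "Y - m \<ge> 0" "Z - m \<ge> 0"
    and face: "X - m = 0 \<or> Y - m = 0 \<or> Z - m = 0"
    using assms by (auto simp: m_def min_def)
  note shift = rt_cubic_shift[OF \<open>s > 0\<close>, of X Y Z m]
  have Q: "rt_quadratic s (X - Z) (Y - Z) \<ge> 0"
    using rt_quadratic_pos[OF \<open>s > 0\<close>, of "X - Z" "Y - Z"]
    by (cases "X - Z = 0 \<and> Y - Z = 0") (auto simp: rt_quadratic_def)
  then have mQ: "m * rt_quadratic s (X - Z) (Y - Z) \<ge> 0"
    using m(1) by simp
  have F: "rt_cubic s (X - m) (Y - m) (Z - m) \<ge> 0"
    by (rule rt_cubic_face_nonneg[OF \<open>s > 0\<close> m(2-4) face])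
  show "rt_cubic s X Y Z \<ge> 0"
    using mQ F shift by linarith
  show "rt_cubic s X Y Z = 0 \<longleftrightarrow>
      X = Y \<and> Y = Z \<or> X = 0 \<and> Y = Z \<or> Y = 0 \<and> X = Z \<or> Z = 0 \<and> Y = s * X" (is "_ \<longleftrightarrow> ?R")
  proof
    assume 0: "rt_cubic s X Y Z = 0"
    show ?R
    proof (cases "m = 0")
      case True
      with face have "X = 0 \<or> Y = 0 \<or> Z = 0" by simp
      from rt_cubic_face_eq_0[OF assms this 0] show ?thesis by blast
    next
      case False
      \<comment> \<open>Both nonnegative summands of the shift identity must vanish; as
        \<open>m\<close> is nonzero, definiteness then forces the diagonal.\<close>
      have "m * rt_quadratic s (X - Z) (Y - Z) = 0"
        using 0 mQ F shift by linarith
      with False have "rt_quadratic s (X - Z) (Y - Z) = 0" by simp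
      with rt_quadratic_pos[OF \<open>s > 0\<close>, of "X - Z" "Y - Z"] have "X = Z" "Y = Z" by auto
      then show ?thesis by simp
    qed
  next
    assume ?R
    moreover have "rt_cubic s X X X = 0" by (simp add: rt_cubic_def)
    ultimately show "rt_cubic s X Y Z = 0"
      using \<open>s > 0\<close> by (auto simp: rt_cubic_faces)
  qed
qed

section \<open>Nonnegativity, zeros and the failure of sos\<close>

lemma psd_Rt_form: "t > 0 \<Longrightarrow> psd (Rt_form t)"
  by (simp add: psd_def peval_Rt_form rt_cubic_nonneg_and_zeros(1))

text \<open>Up to scaling, the nonzero solutions of the four alternatives number 4, 2, 2 and
  2.\<close>

lemma peval_Rt_form_eq_0_iff:
  assumes "t > 0"
  shows "peval (Rt_form t) v = 0 \<longleftrightarrow>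
    (v $ 1)\<^sup>2 = (v $ 2)\<^sup>2 \<and> (v $ 2)\<^sup>2 = (v $ 3)\<^sup>2 \<or> v $ 1 = 0 \<and> (v $ 2)\<^sup>2 = (v $ 3)\<^sup>2
    \<or> v $ 2 = 0 \<and> (v $ 1)\<^sup>2 = (v $ 3)\<^sup>2 \<or> v $ 3 = 0 \<and> (v $ 2)\<^sup>2 = (t * v $ 1)\<^sup>2"
  using assms by (simp add: peval_Rt_form rt_cubic_nonneg_and_zeros(2) power_mult_distrib)

lemma not_sos_Rt_form:
  assumes "t > 0"
  shows "\<not> sos (Rt_form t)"
proof
  assume "sos (Rt_form t)"
  then obtain n :: nat and q where form: "\<forall>k<n. \<exists>d. is_form d (q k)"
    and sum: "Rt_form t = (\<Sum>k<n. (q k)\<^sup>2)"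
    unfolding sos_def by blast
  \<comment> \<open>This bound transfers zeros of R_t to every summand and also limits the growth of
    each summand.\<close>
  have bound: "(peval (q k) v)\<^sup>2 \<le> peval (Rt_form t) v" if "k < n" for k v
    unfolding sum using that
    by (simp, intro member_le_sum) auto
  let ?e = "vector [0, 0, 1] :: real ^ 3"
  have one: "peval (Rt_form t) ?e = 1"
    by (simp add: peval_Rt_form rt_cubic_def)
  have "peval (q k) ?e = 0" if k: "k < n" for k
  proof -
    obtain d where d: "is_form d (q k)" using form k by blast
    show ?thesis
    proof (cases "d \<le> 3")
      case True
      have "peval (q k) v = 0" if "peval (Rt_form t) v = 0" for v
        using bound[OF k, of v] that by simp
      with low_degree_form_vanishes_at_centre[OF d True] show ?thesis
        by (simp add: peval_Rt_form_eq_0_iff[OF assms])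
    next
      \<comment> \<open>A summand of degree above 3 would outgrow \<open>R\<^sub>t\<close> along the \<open>z\<close>-axis.\<close>
      case False
      show ?thesis
      proof (rule ccontr)
        define c where "c = (peval (q k) ?e)\<^sup>2"
        assume "peval (q k) ?e \<noteq> 0"
        then have c: "c > 0" by (simp add: c_def)
        \<comment> \<open>The degree is at least 4, so \<open>r ^ 7 * c \<le> r ^ 6\<close> and
          hence \<open>r * c \<le> 1\<close>, whereas this choice gives
          \<open>r * c = c + 1\<close>.\<close>
        define r where "r = 1 + 1 / c"
        have r: "r \<ge> 1" using c by (simp add: r_def)
        have "(r ^ d * peval (q k) ?e)\<^sup>2 \<le> r ^ 6"
          using bound[OF k, of "r *\<^sub>R ?e"]
          by (simp add: peval_form_scale[OF d] peval_form_scale[OF is_form_Rt_form] one)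
        then have le: "r ^ (2 * d) * c \<le> r ^ 6"
          by (simp add: c_def power_mult_distrib power_mult mult.commute flip: power_mult)
        have "r ^ 6 * (r * c) = r ^ 7 * c" by (simp add: power_numeral_reduce)
        also have "\<dots> \<le> r ^ (2 * d) * c"
          using False r c by (intro mult_right_mono power_increasing) auto
        finally have "r ^ 6 * (r * c) \<le> r ^ 6 * 1" using le by simp
        then have "r * c \<le> 1" using r by simp
        then show False using c by (simp add: r_def distrib_right)
      qed
    qed
  qed
  then have "peval (Rt_form t) ?e = 0" by (simp add: sum)
  with one show False by simp
qed

section \<open>Counting the zeros as projective points\<close>

text \<open>A factor between two such vectors can be read off at the first nonzero coordinate, which
  is 1 in both. Only the line through (0, 0, 1) has no such representative, and R_t is 1
  there.\<close>

lemma inj_on_span_normalized: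
  "inj_on (\<lambda>v. span {v}) {v :: real ^ 3. v $ 1 = 1 \<or> v $ 1 = 0 \<and> v $ 2 = 1}"
proof (rule inj_onI)
  fix v w :: "real ^ 3"
  assume *: "v \<in> {v. v $ 1 = 1 \<or> v $ 1 = 0 \<and> v $ 2 = 1}"
    "w \<in> {v. v $ 1 = 1 \<or> v $ 1 = 0 \<and> v $ 2 = 1}" and "span {v} = span {w}"
  then have "v \<in> span {w}" using span_base[of v "{v}"] by simp
  then obtain c where c: "v = c *\<^sub>R w" by (auto simp: span_singleton)
  moreover have "v \<noteq> 0" using * by auto
  ultimately have "c = 1" using * by auto
  with c show "v = w" by simp
qed

lemma span_scaleR_singleton:
  fixes v :: "'a::real_vector"
  assumes "c \<noteq> 0"
  shows "span {c *\<^sub>R v} = span {v}"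
proof -
  have "v \<in> span {c *\<^sub>R v}"
    using span_scale[OF span_base[of "c *\<^sub>R v" "{c *\<^sub>R v}"], of "1 / c"] assms by simp
  then show ?thesis
    by (simp add: span_eq span_scale span_base)
qed

text \<open>The first nonzero coordinate is scaled to 1. Triples instead of vectors let
  simplification decide distinctness.\<close>

definition zero_reps :: "real \<Rightarrow> (real \<times> real \<times> real) set" where
  "zero_reps t = {(1, 1, 1), (1, 1, - 1), (1, - 1, 1), (1, - 1, - 1), (1, t, 0), (1, - t, 0),
     (1, 0, 1), (1, 0, - 1), (0, 1, 1), (0, 1, - 1)}"

lemma zero_lines_Rt_form:
  assumes "t > 0"
  shows "zero_lines (Rt_form t) = (\<lambda>(x, y, z). span {vector [x, y, z]}) ` zero_reps t"
    (is "_ = ?f ` _")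
proof (intro subset_antisym subsetI)
  fix L assume "L \<in> zero_lines (Rt_form t)"
  then obtain v where L: "L = span {v}" and "v \<noteq> 0" and 0: "peval (Rt_form t) v = 0"
    by (auto simp: zero_lines_def)
  \<comment> \<open>This is the first nonzero coordinate: a zero with
    \<open>v $ 1 = v $ 2 = 0\<close> would also have \<open>v $ 3 = 0\<close>.\<close>
  define c where "c = (if v $ 1 = 0 then v $ 2 else v $ 1)"
  from \<open>v \<noteq> 0\<close> 0 assms have "c \<noteq> 0"
    by (auto simp: c_def peval_Rt_form_eq_0_iff vec_eq_iff forall_3)
  have "(v $ 1 / c, v $ 2 / c, v $ 3 / c) \<in> zero_reps t"
    using 0 \<open>c \<noteq> 0\<close> assms
    by (auto simp: c_def zero_reps_def peval_Rt_form_eq_0_iff power2_eq_iff split: if_splits)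
  moreover have "v = c *\<^sub>R vector [v $ 1 / c, v $ 2 / c, v $ 3 / c]"
    using \<open>c \<noteq> 0\<close> by (simp add: vec_eq_iff forall_3)
  then have "L = ?f (v $ 1 / c, v $ 2 / c, v $ 3 / c)"
    using span_scaleR_singleton[OF \<open>c \<noteq> 0\<close>] L by (metis case_prod_conv)
  ultimately show "L \<in> ?f ` zero_reps t" by blast
next
  fix L assume "L \<in> ?f ` zero_reps t"
  then obtain x y z where L: "L = span {vector [x, y, z]}" and "(x, y, z) \<in> zero_reps t"
    by auto
  then have "peval (Rt_form t) (vector [x, y, z]) = 0" "vector [x, y, z] \<noteq> (0 :: real ^ 3)"
    using assms
    by (auto simp: zero_reps_def peval_Rt_form_eq_0_iff vec_eq_iff forall_3)
  with L show "L \<in> zero_lines (Rt_form t)"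
    by (auto simp: zero_lines_def)
qed

lemma card_zero_lines_Rt_form:
  assumes "t > 0"
  shows "card (zero_lines (Rt_form t)) = 10"
proof -
  let ?vec = "\<lambda>(x, y, z). vector [x, y, z] :: real ^ 3"
  have "inj_on ?vec A" for A
    by (auto simp: inj_on_def vec_eq_iff forall_3)
  moreover have "inj_on (\<lambda>v. span {v}) (?vec ` zero_reps t)"
    by (rule inj_on_subset[OF inj_on_span_normalized]) (auto simp: zero_reps_def)
  ultimately have "inj_on ((\<lambda>v. span {v}) \<circ> ?vec) (zero_reps t)"
    by (intro comp_inj_on)
  then have "inj_on (\<lambda>(x, y, z). span {vector [x, y, z] :: real ^ 3}) (zero_reps t)"
    by (simp add: comp_def case_prod_unfold)
  then have "card (zero_lines (Rt_form t)) = card (zero_reps t)"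
    by (simp add: zero_lines_Rt_form[OF assms] card_image)
  \<comment> \<open>Positivity of \<open>t\<close> separates \<open>(1, t, 0)\<close> from
    \<open>(1, - t, 0)\<close>.\<close>
  also have "\<dots> = 10"
    using assms by (simp add: zero_reps_def)
  finally show ?thesis .
qed

text \<open>Both extra coefficients vanish at 1, since \<open>1 + 2 - 3 = 0\<close>.\<close>

lemma Rt_form_1: "Rt_form 1 = R_form"
  by (simp add: Rt_form_def Const_def)

theorem mainTheorem8:
  shows "(\<forall>t::real. t > 0 \<longrightarrow> Rt_form t \<in> Delta_3_6 \<and> card (zero_lines (Rt_form t)) = 10)
         \<and> Rt_form 1 = R_form"
  by (simp add: Delta_3_6_def is_form_Rt_form psd_Rt_form not_sos_Rt_form
      card_zero_lines_Rt_form Rt_form_1)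

end
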